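(* Let $X$ be an infinite-dimensional real Banach space. The following assertions are equivalent: (i) the norm on $X$ is locally octahedral; (ii) if $S_X\subset B(x,r)\cup B(-x,r)$ for some $x\in X$ and $r>0$, then $S_X\subset B(x,r)$; (iii) if $S_X\subset B(x,r)\cup B(-x,r)$ for some $x\in S_X$ and $r>0$, then $S_X\subset B(x,r)$.
   Context: $S_X$ denotes the unit sphere $\{x\in X: \|x\|=1\}$ of $X$, and $B(x,r)$ denotes the closed ball in $X$ with center $x\in X$ and radius $r>0$. The norm on a Banach space $X$ is called locally octahedral if, for every $x\in X$ and $\varepsilon>0$, there is a $y\in S_X$ such that $\|sx-y\|\geq(1-\varepsilon)\bigl(|s|\,\|x\|+\|y\|\bigr)$ for all $s\in\mathbb R$. *)

theory Defs
  imports "HOL-Analysis.Analysis"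
begin

definition infinite_dimensional :: "'a::real_vector itself \<Rightarrow> bool" where
  "infinite_dimensional TYPE('a) \<longleftrightarrow> \<not> (\<exists>B::'a set. finite B \<and> span B = UNIV)"

definition locally_octahedral :: "'a::real_normed_vector itself \<Rightarrow> bool" where
  "locally_octahedral TYPE('a) \<longleftrightarrow>
     (\<forall>(x::'a) (\<epsilon>::real). \<epsilon> > 0 \<longrightarrow>
       (\<exists>y\<in>sphere 0 1. \<forall>s::real.
          norm (s *\<^sub>R x - y) \<ge> (1 - \<epsilon>) * (\<bar>s\<bar> * norm x + norm y)))"

end

(* If S is covered by B(x,r) and B(-x,r) with norm x = 1 and r < 2, then S is not contained in B(x,r),
   because -x lies at distance 2 from x.  Hence (iii) says exactly that for every unit x some unit y is
   almost at distance 2 from both x and -x.  By the triangle inequality this already controls the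
   distance from y to all multiples of x, which is local octahedrality. *)
theory Submission
  imports Defs
begin

text \<open>Triangle inequality, split at s = 1 so that the correction has a nonnegative
  coefficient: s(x - y) = (sx - y) - (s - 1)y for s \<ge> 1, and x - y = (sx - y) + (1 - s)x for s <
  1. The lower bounds s + 1 - s\<delta> and s + 1 - \<delta> both dominate (1 - \<delta>)(s +
  1).\<close>

lemma norm_scaleR_diff_ge:
  fixes x y :: "'a::real_normed_vector"
  assumes "norm x = 1" "norm y = 1" "norm (x - y) \<ge> 2 - \<delta>" "0 \<le> \<delta>" "0 \<le> s"
  shows "norm (s *\<^sub>R x - y) \<ge> (1 - \<delta>) * (s + 1)"
proof (cases "s \<ge> 1")
  case True
  have "norm (s *\<^sub>R (x - y)) \<le> norm (s *\<^sub>R x - y) + norm ((s - 1) *\<^sub>R y)"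
    using norm_triangle_ineq4[of "s *\<^sub>R x - y" "(s - 1) *\<^sub>R y"] by (simp add: algebra_simps)
  moreover have "s * (2 - \<delta>) \<le> norm (s *\<^sub>R (x - y))"
    using assms by (simp add: mult_left_mono)
  moreover have "norm ((s - 1) *\<^sub>R y) = s - 1"
    using True assms by simp
  ultimately have "s * (2 - \<delta>) - (s - 1) \<le> norm (s *\<^sub>R x - y)"
    by linarith
  then show ?thesis
    using assms by (simp add: algebra_simps)
next
  case False
  have "norm (x - y) \<le> norm (s *\<^sub>R x - y) + norm ((1 - s) *\<^sub>R x)"
    using norm_triangle_ineq[of "s *\<^sub>R x - y" "(1 - s) *\<^sub>R x"] by (simp add: algebra_simps)
  then have "2 - \<delta> - (1 - s) \<le> norm (s *\<^sub>R x - y)"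
    using False assms by simp
  moreover have "0 \<le> \<delta> * s"
    using assms by simp
  ultimately show ?thesis
    by (simp add: algebra_simps)
qed

lemma norm_scaleR_diff_ge_abs:
  fixes x y :: "'a::real_normed_vector"
  assumes "norm x = 1" "norm y = 1" "norm (x - y) \<ge> 2 - \<delta>" "norm (x + y) \<ge> 2 - \<delta>" "0 \<le> \<delta>"
  shows "norm (s *\<^sub>R x - y) \<ge> (1 - \<delta>) * (\<bar>s\<bar> + 1)"
proof (cases "s \<ge> 0")
  case True
  then show ?thesis
    using norm_scaleR_diff_ge[of x y \<delta> s] assms by simp
next
  case False
  \<comment> \<open>Replacing x by -x and s by -s leaves sx unchanged, while the bound on x + y
    takes over the role of the bound on x - y.\<close>
  have "norm (- x - y) = norm (x + y)"
    using norm_minus_cancel[of "x + y"] by simp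
  then show ?thesis
    using norm_scaleR_diff_ge[of "- x" y \<delta> "- s"] assms False by simp
qed

text \<open>Octahedrality at s = 1 and s = -1 yields a unit vector at distance almost
  \<open>norm x + 1\<close> from both centres. The cover then forces r \<ge>
  \<open>norm x + 1\<close>, and a ball of such a radius around x contains the whole unit
  sphere.\<close>

lemma locally_octahedral_imp_sphere_subset_cball:
  fixes x :: "'a::real_normed_vector"
  assumes "locally_octahedral TYPE('a)" and cover: "sphere 0 1 \<subseteq> cball x r \<union> cball (- x) r"
  shows "sphere 0 1 \<subseteq> cball x r"
proof -
  have "norm x + 1 \<le> r + e" if "e > 0" for e
  proof -
    \<comment> \<open>Scaled so that the relative loss \<epsilon> becomes the absolute loss
      e.\<close>
    define \<epsilon> where "\<epsilon> = e / (norm x + 1)"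
    have pos: "norm x + 1 > 0"
      by (simp add: add_nonneg_pos)
    then have "\<epsilon> > 0"
      using that by (simp add: \<epsilon>_def)
    then obtain y :: 'a where y: "y \<in> sphere 0 1"
      and oct: "\<And>s. norm (s *\<^sub>R x - y) \<ge> (1 - \<epsilon>) * (\<bar>s\<bar> * norm x + norm y)"
      using assms(1) unfolding locally_octahedral_def by blast
    have "norm (x - y) \<le> r \<or> norm (- x - y) \<le> r"
      using y cover by (auto simp: dist_norm)
    then have "(1 - \<epsilon>) * (norm x + 1) \<le> r"
      using oct[of 1] oct[of "- 1"] y by auto
    moreover have "(1 - \<epsilon>) * (norm x + 1) = norm x + 1 - e"
      using pos by (simp add: \<epsilon>_def field_simps)
    ultimately show ?thesis
      by simp
  qed
  then have "norm x + 1 \<le> r"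
    by (rule field_le_epsilon)
  then show ?thesis
    by (auto simp: dist_norm intro!: order_trans[OF norm_triangle_ineq4])
qed

text \<open>The hypothesis is used at r = 2 - \<delta>, which is positive. Its conclusion fails at
  the unit vector -x, so the two balls do not cover the sphere, and any uncovered point serves as
  y.\<close>

lemma sphere_subset_cball_imp_far_point:
  fixes x :: "'a::real_normed_vector"
  assumes "\<forall>r>0. sphere 0 1 \<subseteq> cball x r \<union> cball (- x) r \<longrightarrow> sphere 0 1 \<subseteq> cball x r"
    and x: "norm x = 1" and "0 < \<delta>" "\<delta> < 2"
  obtains y where "norm y = 1" "norm (x - y) \<ge> 2 - \<delta>" "norm (x + y) \<ge> 2 - \<delta>"
proof -
  have "dist x (- x) = 2"
    using x by (simp add: dist_norm flip: scaleR_2)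
  then have "- x \<in> sphere 0 1" "- x \<notin> cball x (2 - \<delta>)"
    using assms by auto
  then have "\<not> sphere 0 1 \<subseteq> cball x (2 - \<delta>) \<union> cball (- x) (2 - \<delta>)"
    using assms by (smt (verit) subsetD)
  then obtain y where y: "norm y = 1" "dist x y > 2 - \<delta>" "dist (- x) y > 2 - \<delta>"
    by (force simp: not_le)
  moreover have "dist (- x) y = norm (x + y)"
    using norm_minus_cancel[of "x + y"] by (simp add: dist_norm)
  ultimately show ?thesis
    using that by (simp add: dist_norm)
qed

lemma sphere_subset_cball_imp_locally_octahedral:
  fixes z :: "'a::real_normed_vector"
  assumes ball: "\<forall>(x::'a)\<in>sphere 0 1. \<forall>r>0.
      sphere 0 1 \<subseteq> cball x r \<union> cball (- x) r \<longrightarrow> sphere 0 1 \<subseteq> cball x r"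
    and "z \<noteq> 0"
  shows "locally_octahedral TYPE('a)"
  unfolding locally_octahedral_def
proof (intro allI impI)
  fix x :: 'a and \<epsilon> :: real
  assume "\<epsilon> > 0"
  \<comment> \<open>The direction of x. For x = 0, where \<open>sgn\<close> would give 0, the vector
    z supplies a direction, and x is still \<open>norm x\<close> times u.\<close>
  define u where "u = sgn (if x = 0 then z else x)"
  have u: "norm u = 1" and xu: "x = norm x *\<^sub>R u"
    using \<open>z \<noteq> 0\<close> by (auto simp: u_def norm_sgn sgn_div_norm)
  \<comment> \<open>The cap at 1 keeps \<delta> below 2; a smaller \<delta> only strengthens the
    bound.\<close>
  define \<delta> where "\<delta> = min \<epsilon> 1"
  have \<delta>: "0 < \<delta>" "\<delta> < 2" "\<delta> \<le> \<epsilon>"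
    using \<open>\<epsilon> > 0\<close> by (auto simp: \<delta>_def)
  have "\<forall>r>0. sphere 0 1 \<subseteq> cball u r \<union> cball (- u) r \<longrightarrow> sphere 0 1 \<subseteq> cball u r"
    using ball u by simp
  then obtain y where y: "norm y = 1" "norm (u - y) \<ge> 2 - \<delta>" "norm (u + y) \<ge> 2 - \<delta>"
    using u \<delta>(1,2) by (rule sphere_subset_cball_imp_far_point)
  have "norm (s *\<^sub>R x - y) \<ge> (1 - \<epsilon>) * (\<bar>s\<bar> * norm x + norm y)" for s
  proof -
    \<comment> \<open>Multiples of x are multiples of u, so the estimate for unit vectors applies
      with the scalar \<open>s * norm x\<close>.\<close>
    have "(1 - \<epsilon>) * (\<bar>s * norm x\<bar> + 1) \<le> (1 - \<delta>) * (\<bar>s * norm x\<bar> + 1)"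
      using \<delta> by (intro mult_right_mono) auto
    also have "\<dots> \<le> norm ((s * norm x) *\<^sub>R u - y)"
      using norm_scaleR_diff_ge_abs[of u y \<delta>] u y \<delta> by simp
    also have "(s * norm x) *\<^sub>R u = s *\<^sub>R x"
      using xu by (metis scaleR_scaleR)
    finally show ?thesis
      using y by (simp add: abs_mult)
  qed
  then show "\<exists>y\<in>sphere 0 1. \<forall>s. norm (s *\<^sub>R x - y) \<ge> (1 - \<epsilon>) * (\<bar>s\<bar> * norm x + norm y)"
    using y by (intro bexI[of _ y]) auto
qed

text \<open>The empty set spans only 0. The zero space must be excluded: its unit sphere is empty,
  so (iii) holds vacuously while local octahedrality fails.\<close>

lemma infinite_dimensional_imp_nonzero:
  assumes "infinite_dimensional TYPE('a::real_vector)"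
  obtains z :: "'a::real_vector" where "z \<noteq> 0"
proof -
  have "span {} \<noteq> (UNIV :: 'a set)"
    using assms unfolding infinite_dimensional_def by blast
  then show ?thesis
    using that by auto
qed

theorem proposition3p2:
  assumes "infinite_dimensional TYPE('a::banach)"
  shows "(locally_octahedral TYPE('a) \<longleftrightarrow>
           (\<forall>(x::'a) (r::real). r > 0 \<longrightarrow>
              sphere 0 1 \<subseteq> cball x r \<union> cball (- x) r \<longrightarrow> sphere 0 1 \<subseteq> cball x r)) \<and>
         ((\<forall>(x::'a) (r::real). r > 0 \<longrightarrow>
              sphere 0 1 \<subseteq> cball x r \<union> cball (- x) r \<longrightarrow> sphere 0 1 \<subseteq> cball x r) \<longleftrightarrow>
           (\<forall>(x::'a)\<in>sphere 0 1. \<forall>r::real. r > 0 \<longrightarrow>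
              sphere 0 1 \<subseteq> cball x r \<union> cball (- x) r \<longrightarrow> sphere 0 1 \<subseteq> cball x r))"
proof -
  obtain z :: 'a where "z \<noteq> 0"
    using assms by (rule infinite_dimensional_imp_nonzero)
  let ?ii = "\<forall>(x::'a) (r::real). r > 0 \<longrightarrow>
    sphere 0 1 \<subseteq> cball x r \<union> cball (- x) r \<longrightarrow> sphere 0 1 \<subseteq> cball x r"
  let ?iii = "\<forall>(x::'a)\<in>sphere 0 1. \<forall>r::real. r > 0 \<longrightarrow>
    sphere 0 1 \<subseteq> cball x r \<union> cball (- x) r \<longrightarrow> sphere 0 1 \<subseteq> cball x r"
  have "locally_octahedral TYPE('a) \<Longrightarrow> ?ii"
    using locally_octahedral_imp_sphere_subset_cball by blast
  moreover have "?ii \<Longrightarrow> ?iii"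
    by blast
  moreover have "?iii \<Longrightarrow> locally_octahedral TYPE('a)"
    by (rule sphere_subset_cball_imp_locally_octahedral[OF _ \<open>z \<noteq> 0\<close>])
  ultimately show ?thesis
    by argo
qed

end
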